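(* The Interval Conjecture (IC) holds for the class of level $h$-vectors of socle degree $2$. Precisely: (i) For every given positive integer $t$, the $h$-vector $(1,r,t)$ is level for all integers $r\geq \left(t_{(2)}\right)_{-1}^{-1}$, the lower bound being sharp (i.e. $(1,r,t)$ is not a level $h$-vector for smaller $r$). (ii) For every given positive integer $r$, the $h$-vector $(1,r,t)$ is level for all integers $t$ such that $1\leq t\leq \binom{r+1}{2}$, the upper bound being sharp (i.e. $(1,r,t)$ is not a level $h$-vector for larger $t$).
   Context: Let $k$ be a field of characteristic zero. All algebras are standard graded artinian algebras $A=R/I$, where $R=k[x_1,\dots,x_r]$, all $x_i$ have degree $1$, and $I$ is a homogeneous ideal of $R$ containing no nonzero forms of degree $1$. The $h$-vector of $A$ is $h(A)=(h_0,h_1,\dots,h_e)$, where $h_i=\dim_k A_i$ and $e$ is the last index with $\dim_k A_e>0$; thus $h_0=1$. The number $r=h_1$ is the codimension of $A$ (or of $h$), and $e$ is the socle degree. The socle of $A$ is the annihilator in $A$ of its homogeneous maximal ideal. $A$ is level of type $t$ if its socle is concentrated in degree $e$ and has dimension $t=h_e$. An $h$-vector is level if it is the $h$-vector of some level standard graded artinian algebra $A=k[x_1,\dots,x_r]/I$, where all $x_i$ have degree $1$ and $I$ is a homogeneous ideal containing no nonzero forms of degree $1$. For positive integers $n$ and $i$, the $i$-binomial expansion of $n$ is the unique expression $n_{(i)}=\binom{n_i}{i}+\binom{n_{i-1}}{i-1}+\dots+\binom{n_j}{j}$ with $n_i>n_{i-1}>\dots>n_j\geq j\geq 1$. For an integer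 $a$, define $\left(n_{(i)}\right)_{a}^{a}=\binom{n_i+a}{i+a}+\binom{n_{i-1}+a}{i-1+a}+\dots+\binom{n_j+a}{j+a}$. For example, $25_{(2)}=\binom{7}{2}+\binom{4}{1}$, so $\left(25_{(2)}\right)_{-1}^{-1}=\binom{6}{1}+\binom{3}{0}=7$. The IC holds for a class $\mathcal{C}$ of $h$-vectors if: whenever, for some index $i$ and some positive integer $\alpha$, both $(1,h_1,\dots,h_i,\dots,h_e)$ and $(1,h_1,\dots,h_i+\alpha,\dots,h_e)$ (differing only in degree $i$) belong to $\mathcal{C}$, then $(1,h_1,\dots,h_i+\beta,\dots,h_e)$ belongs to $\mathcal{C}$ for every integer $\beta=0,1,\dots,\alpha$. *)

theory Defs
  imports
    "HOL-Algebra.QuotRing"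
    "HOL-Algebra.Embedded_Algebras"
    "HOL-Library.Poly_Mapping"
begin

section \<open>Polynomial rings and their homogeneous ideals\<close>

text \<open>
  A power product is an exponent vector with finite support, and a polynomial is a finitely
  supported family of coefficients indexed by power products. The variables are
  \<open>x\<^sub>0, x\<^sub>1, \<dots>\<close>; the ring \<open>k[x\<^sub>1,\<dots>,x\<^sub>r]\<close> is rendered with the indices \<open>0, \<dots>, r - 1\<close>.
\<close>

type_synonym 'k mpoly = "(nat \<Rightarrow>\<^sub>0 nat) \<Rightarrow>\<^sub>0 'k"

definition pp_degree :: "(nat \<Rightarrow>\<^sub>0 nat) \<Rightarrow> nat"
  where "pp_degree m = (\<Sum>i\<in>Poly_Mapping.keys m. Poly_Mapping.lookup m i)"

definition polys :: "nat \<Rightarrow> 'k::field mpoly set"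
  where "polys r = {p. \<forall>m\<in>Poly_Mapping.keys p. Poly_Mapping.keys m \<subseteq> {..<r}}"

definition poly_ring :: "nat \<Rightarrow> 'k::field mpoly ring"
  where "poly_ring r = \<lparr>carrier = polys r, mult = (*), one = 1, zero = 0, add = (+)\<rparr>"

definition forms :: "nat \<Rightarrow> nat \<Rightarrow> 'k::field mpoly set"
  where "forms r d = {p \<in> polys r. \<forall>m\<in>Poly_Mapping.keys p. pp_degree m = d}"

definition homogeneous_ideal :: "nat \<Rightarrow> 'k::field mpoly set \<Rightarrow> bool"
  where "homogeneous_ideal r I \<longleftrightarrow>
    ideal I (poly_ring r) \<and> (\<exists>S \<subseteq> (\<Union>d. forms r d). I = genideal (poly_ring r) S)"


section \<open>Standard graded artinian algebras\<close>

text \<open>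
  An algebra \<open>A = R/I\<close> is given by its presentation: the number \<open>r\<close> of variables and the
  ideal \<open>I\<close> of \<open>R = k[x\<^sub>1,\<dots>,x\<^sub>r]\<close>.
\<close>

definition quot_alg :: "nat \<Rightarrow> 'k::field mpoly set \<Rightarrow> 'k mpoly set ring"
  where "quot_alg r I = poly_ring r Quot I"

definition residue_class :: "nat \<Rightarrow> 'k::field mpoly set \<Rightarrow> 'k mpoly \<Rightarrow> 'k mpoly set"
  where "residue_class r I f = I +>\<^bsub>poly_ring r\<^esub> f"

text \<open>The ground field as a subset of \<open>A\<close>; the vector space structure of \<open>A\<close> is multiplication by
  elements of this set.\<close>

definition ground_field :: "nat \<Rightarrow> 'k::field mpoly set \<Rightarrow> 'k mpoly set set"
  where "ground_field r I = (\<lambda>c. residue_class r I (Poly_Mapping.single 0 c)) ` UNIV"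

definition graded_part :: "nat \<Rightarrow> 'k::field mpoly set \<Rightarrow> nat \<Rightarrow> 'k mpoly set set"
  where "graded_part r I d = residue_class r I ` forms r d"

definition has_dim :: "nat \<Rightarrow> 'k::field mpoly set \<Rightarrow> 'k mpoly set set \<Rightarrow> nat \<Rightarrow> bool"
  where "has_dim r I V n \<longleftrightarrow> ring.dimension (quot_alg r I) n (ground_field r I) V"

definition artinian :: "('a, 'b) ring_scheme \<Rightarrow> bool"
  where "artinian A \<longleftrightarrow> cring A \<and>
    (\<forall>J :: nat \<Rightarrow> 'a set. (\<forall>n. ideal (J n) A) \<and> (\<forall>n. J (Suc n) \<subseteq> J n)
      \<longrightarrow> (\<exists>N. \<forall>n\<ge>N. J n = J N))"

definition standard_graded_artinian :: "nat \<Rightarrow> 'k::field mpoly set \<Rightarrow> bool"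
  where "standard_graded_artinian r I \<longleftrightarrow>
    homogeneous_ideal r I \<and> (\<forall>f\<in>I \<inter> forms r 1. f = 0) \<and> artinian (quot_alg r I)"

text \<open>The list \<open>h = [h\<^sub>0, \<dots>, h\<^sub>e]\<close> stops at the last nonzero graded part. In particular the zero
  ring has no h-vector.\<close>

definition has_h_vector :: "nat \<Rightarrow> 'k::field mpoly set \<Rightarrow> nat list \<Rightarrow> bool"
  where "has_h_vector r I h \<longleftrightarrow>
    h \<noteq> [] \<and> last h > 0 \<and>
    (\<forall>i<length h. has_dim r I (graded_part r I i) (h ! i)) \<and>
    (\<forall>i\<ge>length h. has_dim r I (graded_part r I i) 0)"

definition socle_degree :: "nat list \<Rightarrow> nat"
  where "socle_degree h = length h - 1"

definition homogeneous_maximal_ideal :: "nat \<Rightarrow> 'k::field mpoly set \<Rightarrow> 'k mpoly set set"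
  where "homogeneous_maximal_ideal r I =
    residue_class r I ` {f \<in> polys r. Poly_Mapping.lookup f 0 = 0}"

definition socle :: "nat \<Rightarrow> 'k::field mpoly set \<Rightarrow> 'k mpoly set set"
  where "socle r I = {a \<in> carrier (quot_alg r I).
    \<forall>x\<in>homogeneous_maximal_ideal r I. x \<otimes>\<^bsub>quot_alg r I\<^esub> a = \<zero>\<^bsub>quot_alg r I\<^esub>}"

definition level_of_type :: "nat \<Rightarrow> 'k::field mpoly set \<Rightarrow> nat list \<Rightarrow> nat \<Rightarrow> bool"
  where "level_of_type r I h t \<longleftrightarrow>
    socle r I \<subseteq> graded_part r I (socle_degree h) \<and> has_dim r I (socle r I) t \<and> t = last h"

text \<open>The first argument only fixes the ground field \<open>k\<close>.\<close>

definition level_h_vector :: "'k::field itself \<Rightarrow> nat list \<Rightarrow> bool"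
  where "level_h_vector K h \<longleftrightarrow>
    (\<exists>r (I :: 'k mpoly set). standard_graded_artinian r I \<and> has_h_vector r I h \<and>
      (\<exists>t. level_of_type r I h t))"


section \<open>Binomial expansions\<close>

text \<open>
  The list \<open>ns = [n\<^sub>i, n\<^sub>i\<^sub>-\<^sub>1, \<dots>, n\<^sub>j]\<close> has \<open>i - j + 1\<close> entries, so its last index is
  \<open>j = i + 1 - length ns\<close>, and \<open>ns ! l\<close> is \<open>n\<^sub>i\<^sub>-\<^sub>l\<close>. The condition \<open>length ns \<le> i\<close> says \<open>j \<ge> 1\<close>.
\<close>

definition is_binomial_expansion :: "nat \<Rightarrow> nat \<Rightarrow> nat list \<Rightarrow> bool"
  where "is_binomial_expansion i n ns \<longleftrightarrow>
    ns \<noteq> [] \<and> length ns \<le> i \<and> sorted_wrt (>) ns \<and> last ns \<ge> i + 1 - length ns \<and>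
    n = (\<Sum>l<length ns. (ns ! l) choose (i - l))"

definition binomial_expansion :: "nat \<Rightarrow> nat \<Rightarrow> nat list"
  where "binomial_expansion i n = (THE ns. is_binomial_expansion i n ns)"

definition int_binomial :: "int \<Rightarrow> int \<Rightarrow> nat"
  where "int_binomial m q = (if 0 \<le> q \<and> q \<le> m then nat m choose nat q else 0)"

definition shifted_expansion :: "nat \<Rightarrow> nat \<Rightarrow> int \<Rightarrow> nat"
  where "shifted_expansion n i a =
    (let ns = binomial_expansion i n
     in \<Sum>l<length ns. int_binomial (int (ns ! l) + a) (int (i - l) + a))"


section \<open>The interval property\<close>

definition interval_conjecture_holds :: "nat list set \<Rightarrow> bool"
  where "interval_conjecture_holds C \<longleftrightarrow>
    (\<forall>h i \<alpha>. 1 \<le> i \<and> i < length h \<and> \<alpha> > 0 \<and> h \<in> C \<and> h[i := h ! i + \<alpha>] \<in> C \<longrightarrow>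
      (\<forall>\<beta>\<le>\<alpha>. h[i := h ! i + \<beta>] \<in> C))"

end

theory Submission
  imports Defs
begin

text \<open>
  Everything reduces to the equivalence: \<open>(1, r, t)\<close> is level if and only if
  \<open>1 \<le> t \<le> (r + 1) choose 2\<close>. The bound on \<open>t\<close> is the number of quadratic monomials, which span
  \<open>A\<^sub>2\<close>. For the converse, choose a set \<open>S\<close> of \<open>t\<close> quadratic monomials containing \<open>x\<^sub>0\<^sup>2\<close>, and let \<open>A\<close>
  be the quotient in which every square \<open>x\<^sub>j\<^sup>2\<close> outside \<open>S\<close> is identified with \<open>x\<^sub>0\<^sup>2\<close>, while all mixed
  quadratic monomials outside \<open>S\<close> and all monomials of degree at least three vanish. Then \<open>S\<close> is a
  basis of \<open>A\<^sub>2\<close>, and no nonzero linear form \<open>\<ell>\<close> lies in the socle: if \<open>x\<^sub>j\<close> occurs in \<open>\<ell>\<close>, then the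
  basis element representing \<open>x\<^sub>j\<^sup>2\<close> occurs in \<open>x\<^sub>j \<ell>\<close>. Finally, shifting the
  \<open>2\<close>-binomial expansion of \<open>t\<close> by \<open>-1\<close> gives the least \<open>r\<close> with \<open>t \<le> (r + 1) choose 2\<close>.
\<close>

section \<open>Monomials\<close>

lemma pp_degree_eq_sum:
  assumes "finite X" "Poly_Mapping.keys m \<subseteq> X"
  shows "pp_degree m = (\<Sum>i\<in>X. Poly_Mapping.lookup m i)"
  unfolding pp_degree_def using assms
  by (intro sum.mono_neutral_left) (auto simp: in_keys_iff)

lemma pp_degree_add [simp]: "pp_degree (m + n) = pp_degree m + pp_degree n"
proof -
  let ?X = "Poly_Mapping.keys m \<union> Poly_Mapping.keys n"
  have "Poly_Mapping.keys (m + n) \<subseteq> ?X"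
    by (rule keys_add)
  then show ?thesis
    by (simp add: pp_degree_eq_sum[of ?X] lookup_add sum.distrib)
qed

lemma pp_degree_zero [simp]: "pp_degree 0 = 0"
  by (simp add: pp_degree_def)

lemma pp_degree_single [simp]: "pp_degree (Poly_Mapping.single i c) = c"
  by (simp add: pp_degree_eq_sum[of "{i}"])

text \<open>Natural-number exponents cannot cancel, so the support of a sum is the whole
  union.\<close>

lemma keys_add_nat:
  "Poly_Mapping.keys (m + n) = Poly_Mapping.keys m \<union> Poly_Mapping.keys (n :: 'a \<Rightarrow>\<^sub>0 nat)"
  by (auto simp: in_keys_iff lookup_add)

lemma pp_split:
  fixes m :: "nat \<Rightarrow>\<^sub>0 nat"
  assumes "m \<noteq> 0"
  obtains i n where "m = Poly_Mapping.single i 1 + n" "i \<in> Poly_Mapping.keys m"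
proof -
  obtain i where i: "i \<in> Poly_Mapping.keys m"
    using assms by fastforce
  \<comment> \<open>The truncated subtraction loses nothing, because the exponent of
    \<open>i\<close> in \<open>m\<close> is at least one.\<close>
  have "m = Poly_Mapping.single i 1 + (m - Poly_Mapping.single i 1)"
    using i
    by (intro poly_mapping_eqI)
      (auto simp: lookup_add lookup_minus lookup_single when_def in_keys_iff)
  with i show thesis
    by (rule that[rotated])
qed

lemma pp_degree_eq_zero_iff [simp]: "pp_degree m = 0 \<longleftrightarrow> m = 0"
  by (cases "m = 0") (auto elim: pp_split)

section \<open>Enumerating monomials, and counting them in degrees one and two\<close>

definition monomials :: "nat \<Rightarrow> nat \<Rightarrow> (nat \<Rightarrow>\<^sub>0 nat) set"
  where "monomials r d = {m. Poly_Mapping.keys m \<subseteq> {..<r} \<and> pp_degree m = d}"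

lemma monomials_zero: "monomials r 0 = {0}"
  by (auto simp: monomials_def)

text \<open>Some variable can be split off a monomial of positive degree. The choice of variable is
  not unique, so this gives finiteness but no count.\<close>

lemma monomials_Suc:
  "monomials r (Suc d) = (\<lambda>(i, m). Poly_Mapping.single i 1 + m) ` ({..<r} \<times> monomials r d)"
proof (intro equalityI subsetI)
  fix m assume m: "m \<in> monomials r (Suc d)"
  then have "m \<noteq> 0"
    by (auto simp: monomials_def)
  then obtain i n where "m = Poly_Mapping.single i 1 + n" "i \<in> Poly_Mapping.keys m"
    by (rule pp_split)
  with m show "m \<in> (\<lambda>(i, m). Poly_Mapping.single i 1 + m) ` ({..<r} \<times> monomials r d)"
    by (auto simp: monomials_def keys_add_nat)
qed (auto simp: monomials_def keys_add_nat)

lemma finite_monomials [simp]: "finite (monomials r d)"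
  by (induction d) (auto simp: monomials_zero monomials_Suc)

lemma monomials_one: "monomials r 1 = (\<lambda>i. Poly_Mapping.single i 1) ` {..<r}"
  using monomials_Suc[of r 0] by (force simp: monomials_zero)

lemma card_monomials_one: "card (monomials r 1) = r"
proof -
  have "inj (\<lambda>i. Poly_Mapping.single i (1::nat))"
    by (intro injI) (metis lookup_single_eq lookup_single_not_eq one_neq_zero)
  then show ?thesis
    by (simp only: monomials_one) (subst card_image, auto intro: inj_on_subset)
qed

text \<open>Sorting the two indices leaves one pair for each quadratic monomial; this is the
  parametrization that can be counted.\<close>

lemma monomials_two:
  "monomials r 2 = (\<lambda>(j, i). Poly_Mapping.single i 1 + Poly_Mapping.single j 1)
    ` (SIGMA j:{..<r}. {..j})" (is "_ = ?f ` ?X")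
proof (intro equalityI subsetI)
  fix m assume "m \<in> monomials r 2"
  then obtain i j where ij: "i < r" "j < r"
    and m: "m = Poly_Mapping.single i 1 + Poly_Mapping.single j 1"
    unfolding numeral_2_eq_2 monomials_Suc[of r "Suc 0"] using monomials_one[of r] by auto
  show "m \<in> ?f ` ?X"
  proof (cases "i \<le> j")
    case True
    then show ?thesis
      using ij m by force
  next
    case False
    then have "m = ?f (i, j)" "(i, j) \<in> ?X"
      using ij m by (auto simp: add.commute)
    then show ?thesis
      by (rule image_eqI)
  qed
qed (auto simp: monomials_def keys_add_nat)

text \<open>The larger index \<open>j\<close> admits \<open>j + 1\<close> smaller or equal partners,
  so the count is the triangular number \<open>1 + ... + r\<close>.\<close>

lemma card_monomials_two: "card (monomials r 2) = (r + 1) choose 2"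
proof -
  let ?f = "\<lambda>(j, i). Poly_Mapping.single i 1 + Poly_Mapping.single j (1::nat)"
  let ?X = "SIGMA j:{..<r}. {..j}"
  have "inj_on ?f ?X"
  proof (rule inj_onI, clarify)
    fix i j i' j' :: nat
    assume le: "i \<le> j" "i' \<le> j'"
      and eq: "Poly_Mapping.single i 1 + Poly_Mapping.single j 1
        = Poly_Mapping.single i' 1 + Poly_Mapping.single j' (1::nat)"
    \<comment> \<open>Compare the exponents of \<open>x_k\<close>. Taking \<open>k\<close> among the
      four indices determines the unordered pair, and the ordering does the rest.\<close>
    have "(1 when i = k) + (1 when j = k) = (1 when i' = k) + ((1 :: nat) when j' = k)" for k
      using arg_cong[OF eq, of "\<lambda>m. Poly_Mapping.lookup m k"]
      by (simp add: lookup_add lookup_single)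
    from this[of i] this[of j] this[of i'] this[of j'] le
    show "j = j' \<and> i = i'"
      by (auto simp: when_def split: if_splits)
  qed
  then have "card (monomials r 2) = card ?X"
    unfolding monomials_two by (rule card_image)
  also have "\<dots> = (\<Sum>j<r. Suc j)"
    by simp
  also have "\<dots> = (r + 1) choose 2"
    by (induction r) (auto simp: numeral_2_eq_2)
  finally show ?thesis .
qed


section \<open>The polynomial ring\<close>

lemma polys_iff_lookup:
  "p \<in> polys r \<longleftrightarrow> (\<forall>m. Poly_Mapping.lookup p m \<noteq> 0 \<longrightarrow> Poly_Mapping.keys m \<subseteq> {..<r})"
  by (auto simp: polys_def in_keys_iff)

lemma zero_in_polys [simp]: "0 \<in> polys r"
  and one_in_polys [simp]: "1 \<in> polys r"
  by (auto simp: polys_iff_lookup lookup_one when_def split: if_splits)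

lemma add_in_polys [simp]: "p \<in> polys r \<Longrightarrow> q \<in> polys r \<Longrightarrow> p + q \<in> polys r"
  using keys_add[of p q] unfolding polys_def by blast

lemma uminus_in_polys [simp]: "p \<in> polys r \<Longrightarrow> - p \<in> polys r"
  by (auto simp: polys_iff_lookup)

lemma diff_in_polys [simp]: "p \<in> polys r \<Longrightarrow> q \<in> polys r \<Longrightarrow> p - q \<in> polys r"
  using keys_diff[of p q] unfolding polys_def by blast

lemma mult_in_polys [simp]: "p \<in> polys r \<Longrightarrow> q \<in> polys r \<Longrightarrow> p * q \<in> polys r"
  using keys_mult[of p q] unfolding polys_def by (fastforce simp: keys_add_nat)

lemma single_in_polys: "Poly_Mapping.keys m \<subseteq> {..<r} \<Longrightarrow> Poly_Mapping.single m c \<in> polys r"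
  by (auto simp: polys_def)

lemma poly_ring_simps [simp]:
  "carrier (poly_ring r) = polys r"
  "x \<otimes>\<^bsub>poly_ring r\<^esub> y = x * y"
  "x \<oplus>\<^bsub>poly_ring r\<^esub> y = x + y"
  "\<one>\<^bsub>poly_ring r\<^esub> = 1"
  "\<zero>\<^bsub>poly_ring r\<^esub> = 0"
  by (simp_all add: poly_ring_def)

lemma cring_poly_ring: "cring (poly_ring r)"
proof (rule cringI)
  show "abelian_group (poly_ring r)"
    by (rule abelian_groupI) (auto simp: algebra_simps intro!: bexI[of _ "- _"])
  show "comm_monoid (poly_ring r)"
    by (rule comm_monoidI) (auto simp: algebra_simps)
qed (simp add: algebra_simps)

lemma ring_poly_ring: "ring (poly_ring r)"
  using cring_poly_ring by (rule cring.axioms)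

lemma a_inv_poly_ring [simp]:
  assumes "p \<in> polys r"
  shows "\<ominus>\<^bsub>poly_ring r\<^esub> p = - p"
proof -
  interpret cring "poly_ring r"
    by (rule cring_poly_ring)
  show ?thesis
    by (rule minus_equality) (use assms in auto)
qed

lemma a_minus_poly_ring [simp]:
  "p \<in> polys r \<Longrightarrow> q \<in> polys r \<Longrightarrow> p \<ominus>\<^bsub>poly_ring r\<^esub> q = p - q"
  by (simp add: a_minus_def)

text \<open>The k-span of the power products in \<open>B\<close>. Graded pieces and the span of a
  chosen basis both have this shape, so dimensions can be computed by adding one power product at a
  time.\<close>

definition supported :: "(nat \<Rightarrow>\<^sub>0 nat) set \<Rightarrow> 'k::field mpoly set"
  where "supported B = {p. Poly_Mapping.keys p \<subseteq> B}"

lemma forms_eq_supported: "forms r d = supported (monomials r d)"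
  by (auto simp: forms_def supported_def monomials_def polys_def)

lemma supported_subset_polys:
  "(\<And>m. m \<in> B \<Longrightarrow> Poly_Mapping.keys m \<subseteq> {..<r}) \<Longrightarrow> supported B \<subseteq> polys r"
  by (auto simp: supported_def polys_def)

lemma forms_subset_polys: "forms r d \<subseteq> polys r"
  by (auto simp: forms_def)

lemma lookup_form_eq_zero:
  "f \<in> forms r d \<Longrightarrow> pp_degree m \<noteq> d \<Longrightarrow> Poly_Mapping.lookup f m = 0"
  by (auto simp: forms_def in_keys_iff)

text \<open>A nonconstant term of \<open>g\<close> would have to meet a term of \<open>f\<close> of
  degree below \<open>d\<close>, and there is none. So up to degree \<open>d\<close> only the
  constant term of \<open>g\<close> acts. With \<open>d = 2\<close> this yields both the ideal
  property and half of the socle computation.\<close>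

lemma lookup_mult_lowest:
  fixes f g :: "'k::field mpoly"
  assumes low: "\<And>m. pp_degree m < d \<Longrightarrow> Poly_Mapping.lookup f m = 0" and m: "pp_degree m \<le> d"
  shows "Poly_Mapping.lookup (g * f) m = Poly_Mapping.lookup g 0 * Poly_Mapping.lookup f m"
proof -
  have "Poly_Mapping.lookup g l * Sum_any (\<lambda>q. Poly_Mapping.lookup f q when m = l + q)
      = (Poly_Mapping.lookup g l * Poly_Mapping.lookup f m when l = 0)" for l
  proof (cases "l = 0")
    case False
    then have "(Poly_Mapping.lookup f q when m = l + q) = 0" for q
      using m low[of q] by (cases "pp_degree l") (auto simp: when_def)
    with False show ?thesis
      by simp
  qed simp
  then show ?thesis
    by (simp add: lookup_mult)
qed

text \<open>The left factor has a single term, so the outer convolution sum collapses; by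
  cancellation of exponents the inner sum has at most one nonzero term.\<close>

lemma lookup_single_mult:
  fixes f :: "'k::field mpoly"
  shows "Poly_Mapping.lookup (Poly_Mapping.single a c * f) m
    = c * Sum_any (\<lambda>q. Poly_Mapping.lookup f q when m = a + q)"
proof -
  have "Poly_Mapping.lookup (Poly_Mapping.single a c) l * Sum_any (\<lambda>q. Poly_Mapping.lookup f q when m = l + q)
      = (c * Sum_any (\<lambda>q. Poly_Mapping.lookup f q when m = l + q) when l = a)" for l
    by (auto simp: lookup_single when_def)
  then show ?thesis
    by (simp add: lookup_mult)
qed

lemma lookup_single_mult_add:
  fixes f :: "'k::field mpoly"
  shows "Poly_Mapping.lookup (Poly_Mapping.single a c * f) (a + m) = c * Poly_Mapping.lookup f m"
  by (simp add: lookup_single_mult)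

lemma lookup_single_mult_eq_0:
  fixes f :: "'k::field mpoly"
  assumes "\<And>q. m \<noteq> a + q"
  shows "Poly_Mapping.lookup (Poly_Mapping.single a c * f) m = 0"
  using assms by (simp add: lookup_single_mult)

definition homogeneous_part :: "nat \<Rightarrow> 'k::field mpoly \<Rightarrow> 'k mpoly"
  where "homogeneous_part d p =
    (\<Sum>m\<in>{m \<in> Poly_Mapping.keys p. pp_degree m = d}. Poly_Mapping.single m (Poly_Mapping.lookup p m))"

lemma lookup_homogeneous_part:
  "Poly_Mapping.lookup (homogeneous_part d p) m =
    (if pp_degree m = d then Poly_Mapping.lookup p m else 0)"
  by (auto simp: homogeneous_part_def lookup_sum lookup_single when_def in_keys_iff)

lemma homogeneous_part_in_forms: "p \<in> polys r \<Longrightarrow> homogeneous_part d p \<in> forms r d"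
  by (auto simp: forms_def polys_iff_lookup in_keys_iff lookup_homogeneous_part split: if_splits)


section \<open>Quotients of the polynomial ring\<close>

lemma (in ring) dimension_trivial_ring:
  assumes "dimension n K E" "carrier R = {\<zero>}"
  shows "n = 0"
proof -
  have "n = 0 \<and> E = {\<zero>}"
    using assms(1) by (induction rule: dimension.induct) (use assms(2) in auto)
  then show ?thesis ..
qed

text \<open>A basis of \<open>V\<close> is an independent family in \<open>W\<close>; if it is as
  long as the dimension of \<open>W\<close>, it spans \<open>W\<close>.\<close>

lemma (in ring) dimension_mono:
  assumes "subfield K R" "dimension m K V" "dimension n K W" "V \<subseteq> W"
  shows "m \<le> n" "m = n \<Longrightarrow> V = W"
proof -
  obtain Vs where Vs: "independent K Vs" "length Vs = m" "Span K Vs = V" "set Vs \<subseteq> carrier R"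
    using exists_base[OF assms(1,2)] by auto
  have W: "set Vs \<subseteq> W"
    using Span_base_incl[OF assms(1) Vs(4)] Vs(3) assms(4) by blast
  show "m \<le> n"
    using independent_length_le_dimension[OF assms(1,3) Vs(1) W] Vs(2) by simp
  show "V = W" if "m = n"
    using independent_length_eq_dimension[OF assms(1,3) Vs(1) W] Vs(2,3) that by simp
qed

text \<open>Ideals are subspaces. From an index where the dimension along the chain is least, all
  later dimensions agree, and then so do the ideals.\<close>

lemma artinian_if_finite_dimension:
  assumes "cring R" "subfield K R" "ring.finite_dimension R K (carrier R)"
  shows "artinian R"
  unfolding artinian_def
proof (intro conjI allI impI)
  interpret cring R by fact
  fix J :: "nat \<Rightarrow> _"
  assume J: "(\<forall>n. ideal (J n) R) \<and> (\<forall>n. J (Suc n) \<subseteq> J n)"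
  have "finite_dimension K (J n)" for n
    using J ideal_is_subalgebra[OF subfieldE(3)[OF assms(2)]]
    by (intro subalbegra_incl_imp_finite_dimension[OF assms(2,3)]) (auto dest: ideal.Icarr)
  then obtain d where d: "\<And>n. dimension (d n) K (J n)"
    unfolding finite_dimension_def by metis
  define N where "N = (ARG_MIN d n. True)"
  have N: "d N \<le> d n" for n
    unfolding N_def by (rule arg_min_nat_le) simp
  have "J n = J N" if "n \<ge> N" for n
  proof (rule dimension_mono(2)[OF assms(2) d d])
    show "J n \<subseteq> J N"
      using lift_Suc_antimono_le[of J N n] J that by blast
    then have "d n \<le> d N"
      by (rule dimension_mono(1)[OF assms(2) d d])
    with N show "d n = d N"
      by (simp add: le_antisym)
  qed
  then show "\<exists>N. \<forall>n\<ge>N. J n = J N"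
    by blast
qed fact

section \<open>Residue classes and the ground field of a presented algebra\<close>

locale presentation =
  fixes r :: nat and I :: "'k::field mpoly set"
  assumes ideal: "ideal I (poly_ring r)"
begin

sublocale I: ideal I "poly_ring r"
  by (rule ideal)

sublocale res: ring_hom_cring "poly_ring r" "quot_alg r I" "residue_class r I"
proof -
  have "residue_class r I = (+>\<^bsub>poly_ring r\<^esub>) I"
    by (simp add: fun_eq_iff residue_class_def)
  then show "ring_hom_cring (poly_ring r) (quot_alg r I) (residue_class r I)"
    unfolding quot_alg_def using I.rcos_ring_hom_cring[OF cring_poly_ring] by simp
qed

lemma mem_polys: "f \<in> I \<Longrightarrow> f \<in> polys r"
  using I.Icarr by simp

lemma residue_class_eq_iff:
  assumes "f \<in> polys r" "g \<in> polys r"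
  shows "residue_class r I f = residue_class r I g \<longleftrightarrow> f - g \<in> I"
  using ring.quotient_eq_iff_same_a_r_cos[OF ring_poly_ring ideal, of f g] assms by (simp add: residue_class_def)

lemma residue_class_eq_zero_iff:
  "f \<in> polys r \<Longrightarrow> residue_class r I f = \<zero>\<^bsub>quot_alg r I\<^esub> \<longleftrightarrow> f \<in> I"
  using residue_class_eq_iff[of f 0] res.hom_zero by simp

lemma carrier_quot_alg: "carrier (quot_alg r I) = residue_class r I ` polys r"
  unfolding quot_alg_def FactRing_simps residue_class_def by auto

lemma residue_class_eq_add:
  "f \<in> polys r \<Longrightarrow> g \<in> polys r \<Longrightarrow>
    residue_class r I f \<oplus>\<^bsub>quot_alg r I\<^esub> residue_class r I g = residue_class r I (f + g)"
  using res.hom_add[of f g] by simp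

lemma residue_class_eq_mult:
  "f \<in> polys r \<Longrightarrow> g \<in> polys r \<Longrightarrow>
    residue_class r I f \<otimes>\<^bsub>quot_alg r I\<^esub> residue_class r I g = residue_class r I (f * g)"
  using res.hom_mult[of f g] by simp

lemma subfield_constants: "subfield (range (Poly_Mapping.single 0)) (poly_ring r :: 'k mpoly ring)"
proof -
  let ?C = "range (Poly_Mapping.single 0) :: 'k mpoly set"
  have sub: "subring ?C (poly_ring r)"
  proof (rule I.subringI)
    show "?C \<subseteq> carrier (poly_ring r)"
      by (auto simp: single_in_polys)
    show "\<one>\<^bsub>poly_ring r\<^esub> \<in> ?C"
      by (simp flip: single_one)
    fix a b assume "a \<in> ?C" "b \<in> ?C"
    then show "a \<otimes>\<^bsub>poly_ring r\<^esub> b \<in> ?C" "a \<oplus>\<^bsub>poly_ring r\<^esub> b \<in> ?C"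
      "\<ominus>\<^bsub>poly_ring r\<^esub> a \<in> ?C"
      by (auto simp: mult_single single_in_polys simp flip: single_add single_uminus)
  qed
  show ?thesis
  proof (rule I.subfieldI)
    show "subcring ?C (poly_ring r)"
      by (rule cring.subcringI'[OF cring_poly_ring sub])
    have "a \<in> Units (poly_ring r \<lparr>carrier := ?C\<rparr>)" if a: "a \<in> ?C - {0}" for a
    proof -
      obtain c :: 'k where c: "a = Poly_Mapping.single 0 c"
        using a by blast
      with a have "c \<noteq> 0"
        by auto
      with c show ?thesis
        by (auto simp: Units_def mult_single intro!: exI[of _ "inverse c"])
    qed
    then show "Units (poly_ring r \<lparr>carrier := ?C\<rparr>) = ?C - {\<zero>\<^bsub>poly_ring r\<^esub>}"
      by (auto simp: Units_def)
  qed
qed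

lemma ground_field_eq: "ground_field r I = residue_class r I ` range (Poly_Mapping.single 0)"
  by (auto simp: ground_field_def)

text \<open>A ring homomorphism maps a subfield onto a subfield once one is not sent to zero, and
  \<open>1 \<notin> I\<close> ensures that.\<close>

lemma subfield_ground_field:
  assumes "1 \<notin> I"
  shows "subfield (ground_field r I) (quot_alg r I)"
  unfolding ground_field_eq
  by (rule res.ring.img_is_subfield(2)[OF subfield_constants])
    (use assms residue_class_eq_zero_iff[of 1] res.hom_one in simp)

text \<open>Splitting off the \<open>m\<close>-term of a polynomial turns a larger support into a
  line extension, the inductive step in the definition of dimension.\<close>

lemma image_supported_insert:
  assumes keys: "\<And>n. n \<in> insert m B \<Longrightarrow> Poly_Mapping.keys n \<subseteq> {..<r}" and "m \<notin> B"
  shows "residue_class r I ` supported (insert m B)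
    = res.S.line_extension (ground_field r I) (residue_class r I (Poly_Mapping.single m 1))
        (residue_class r I ` supported B)" (is "?L = ?R")
proof (intro equalityI subsetI)
  have polys: "(supported B :: 'k mpoly set) \<subseteq> polys r"
    using keys by (intro supported_subset_polys) auto
  have m: "Poly_Mapping.single m c \<in> polys r" for c :: 'k
    using keys by (intro single_in_polys) auto
  have const: "Poly_Mapping.single 0 c \<in> polys r" for c :: 'k
    by (intro single_in_polys) auto
  have comb: "residue_class r I (Poly_Mapping.single 0 c)
        \<otimes>\<^bsub>quot_alg r I\<^esub> residue_class r I (Poly_Mapping.single m 1)
        \<oplus>\<^bsub>quot_alg r I\<^esub> residue_class r I q
      = residue_class r I (Poly_Mapping.single m c + q)" if "q \<in> supported B" for c q
    using that polys m const by (simp add: residue_class_eq_add residue_class_eq_mult mult_single subset_iff)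
  {
    fix a assume "a \<in> ?L"
    then obtain p where p: "p \<in> supported (insert m B)" "a = residue_class r I p"
      by auto
    define c where "c = Poly_Mapping.lookup p m"
    have "p - Poly_Mapping.single m c \<in> supported B"
      using p(1) by (auto simp: supported_def in_keys_iff lookup_minus lookup_single c_def when_def
          split: if_splits)
    from comb[OF this, of c] this show "a \<in> ?R"
      unfolding res.S.line_extension_mem_iff p(2) ground_field_def by force
  next
    fix a assume "a \<in> ?R"
    then obtain c q where q: "q \<in> supported B"
      and a: "a = residue_class r I (Poly_Mapping.single m c + q)"
      unfolding res.S.line_extension_mem_iff ground_field_def using comb by auto
    have "Poly_Mapping.single m c + q \<in> supported (insert m B)"
      using q by (auto simp: supported_def in_keys_iff lookup_add lookup_single when_def
          split: if_splits)
    then show "a \<in> ?L"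
      unfolding a by (rule imageI)
  }
qed

lemma image_supported_empty: "residue_class r I ` supported {} = {\<zero>\<^bsub>quot_alg r I\<^esub>}"
  using res.hom_zero by (simp add: supported_def)

text \<open>The classes of the power products span the image, and each of them raises the dimension
  by one or leaves it unchanged. Only an upper bound results.\<close>

lemma ex_dim_image_supported:
  assumes "finite B" "\<And>n. n \<in> B \<Longrightarrow> Poly_Mapping.keys n \<subseteq> {..<r}"
  shows "\<exists>n\<le>card B. has_dim r I (residue_class r I ` supported B) n"
  using assms
proof (induction rule: finite_induct)
  case empty
  then show ?case
    unfolding has_dim_def image_supported_empty by auto
next
  case (insert m B)
  let ?v = "residue_class r I (Poly_Mapping.single m 1)" and ?E = "residue_class r I ` supported B"
  have v: "?v \<in> carrier (quot_alg r I)"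
    using insert.prems(1) by (auto simp: carrier_quot_alg intro!: imageI single_in_polys)
  have polys: "(supported B :: 'k mpoly set) \<subseteq> polys r"
    using insert.prems by (intro supported_subset_polys) auto
  obtain n where n: "n \<le> card B" "res.S.dimension n (ground_field r I) ?E"
    using insert by (auto simp: has_dim_def)
  have ext: "residue_class r I ` supported (insert m B)
      = res.S.line_extension (ground_field r I) ?v ?E"
    using insert by (intro image_supported_insert) auto
  show ?case
  proof (cases "?v \<in> ?E")
    case False
    show ?thesis
      using res.S.dimension.Suc_dim[OF v False n(2)] n(1) insert.hyps
      by (intro exI[of _ "Suc n"]) (simp add: has_dim_def ext)
  next
    case True
    then obtain q where q: "q \<in> supported B" "?v = residue_class r I q"
      by auto
    \<comment> \<open>The new vector is the class of \<open>q\<close>, which is supported on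
      \<open>B\<close>; replacing it by \<open>q\<close> shows that the line extension adds
      nothing.\<close>
    have "residue_class r I ` supported (insert m B) \<subseteq> ?E"
    proof
      fix a assume "a \<in> residue_class r I ` supported (insert m B)"
      then obtain c p where p: "p \<in> supported B"
        and a: "a = residue_class r I (Poly_Mapping.single 0 c) \<otimes>\<^bsub>quot_alg r I\<^esub> ?v
          \<oplus>\<^bsub>quot_alg r I\<^esub> residue_class r I p"
        unfolding ext res.S.line_extension_mem_iff ground_field_def by auto
      have "Poly_Mapping.single 0 c \<in> polys r"
        by (intro single_in_polys) auto
      then have "a = residue_class r I (Poly_Mapping.single 0 c * q + p)"
        using p q polys
        by (simp add: a q(2) residue_class_eq_add residue_class_eq_mult subset_iff)
      moreover have "Poly_Mapping.single 0 c * q + p \<in> supported B"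
      proof -
        have "Poly_Mapping.lookup (Poly_Mapping.single 0 c * q + p) m = 0" if "m \<notin> B" for m
        proof -
          have "Poly_Mapping.lookup q m = 0" "Poly_Mapping.lookup p m = 0"
            using p q(1) that by (auto simp: supported_def in_keys_iff)
          then show ?thesis
            using lookup_single_mult_add[of 0 c q m] by (simp add: lookup_add)
        qed
        then show ?thesis
          by (auto simp: supported_def in_keys_iff)
      qed
      ultimately show "a \<in> ?E"
        by simp
    qed
    moreover have "?E \<subseteq> residue_class r I ` supported (insert m B)"
      by (auto simp: supported_def)
    ultimately show ?thesis
      using n insert.hyps by (intro exI[of _ n]) (simp add: has_dim_def)
  qed
qed

text \<open>When no nonzero combination of the power products lies in \<open>I\<close>, their
  classes are independent and every insertion raises the dimension.\<close>

lemma has_dim_image_supported: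
  assumes "finite B" "\<And>n. n \<in> B \<Longrightarrow> Poly_Mapping.keys n \<subseteq> {..<r}"
    and "supported B \<inter> I \<subseteq> {0}"
  shows "has_dim r I (residue_class r I ` supported B) (card B)"
  using assms
proof (induction rule: finite_induct)
  case empty
  then show ?case
    unfolding has_dim_def image_supported_empty by auto
next
  case (insert m B)
  let ?v = "residue_class r I (Poly_Mapping.single m 1)" and ?E = "residue_class r I ` supported B"
  have v: "?v \<in> carrier (quot_alg r I)"
    using insert.prems(1) by (auto simp: carrier_quot_alg intro!: imageI single_in_polys)
  have "supported B \<subseteq> supported (insert m B)"
    by (auto simp: supported_def)
  then have E: "res.S.dimension (card B) (ground_field r I) ?E"
    using insert by (auto simp: has_dim_def)
  \<comment> \<open>Otherwise \<open>Poly_Mapping.single m 1 - q\<close> would be an element of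
    \<open>I\<close> supported on \<open>insert m B\<close>, hence zero, although \<open>q\<close>
    has no \<open>m\<close>-term.\<close>
  have "?v \<notin> ?E"
  proof
    assume "?v \<in> ?E"
    then obtain q where q: "q \<in> supported B" "?v = residue_class r I q"
      by auto
    have "q \<in> polys r"
      using q(1) insert.prems(1) supported_subset_polys[of B r] by auto
    then have "Poly_Mapping.single m 1 - q \<in> I"
      using q(2) residue_class_eq_iff insert.prems(1) by (simp add: single_in_polys)
    moreover have "Poly_Mapping.single m 1 - q \<in> supported (insert m B)"
      using q(1) by (auto simp: supported_def in_keys_iff lookup_minus lookup_single when_def
          split: if_splits)
    ultimately have "q = Poly_Mapping.single m 1"
      using insert.prems(2) by auto
    with q(1) insert.hyps(2) show False
      by (auto simp: supported_def)
  qed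
  from res.S.dimension.Suc_dim[OF v this E] show ?case
    using image_supported_insert[of m B] insert by (simp add: has_dim_def)
qed

lemma graded_part_eq: "graded_part r I d = residue_class r I ` supported (monomials r d)"
  by (simp add: graded_part_def forms_eq_supported)

end


section \<open>Constraints on level h-vectors of socle degree two\<close>

text \<open>A proper ideal without nonzero linear forms imposes no relation in degrees zero and one,
  so the first two entries count monomials: 1 and the number of variables. In degree two the
  monomials span, which bounds the last entry.\<close>

lemma level_h_vector_length_3D:
  assumes "level_h_vector TYPE('k::field) h" "length h = 3"
  obtains r t where "h = [1, r, t]" "0 < t" "t \<le> (r + 1) choose 2"
proof -
  from assms(1) obtain r and I :: "'k mpoly set" where
    I: "homogeneous_ideal r I" "\<forall>f\<in>I \<inter> forms r 1. f = 0" and h: "has_h_vector r I h"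
    unfolding level_h_vector_def standard_graded_artinian_def by auto
  interpret presentation r I
    using I(1) by (intro presentation.intro) (simp add: homogeneous_ideal_def)
  have dims: "has_dim r I (graded_part r I i) (h ! i)" if "i < 3" for i
    using h that assms(2) by (simp add: has_h_vector_def)
  have pos: "0 < h ! 2"
    using h assms(2) by (auto simp: has_h_vector_def last_conv_nth)
  \<comment> \<open>For \<open>1 \<in> I\<close> the quotient is the zero ring, all of whose
    dimensions vanish, against \<open>h ! 2 > 0\<close>.\<close>
  have one: "1 \<notin> I"
  proof
    assume "1 \<in> I"
    then have "I = polys r"
      using I.one_imp_carrier by simp
    then have "\<And>f. f \<in> polys r \<Longrightarrow> residue_class r I f = \<zero>\<^bsub>quot_alg r I\<^esub>"
      using residue_class_eq_zero_iff by blast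
    then have "carrier (quot_alg r I) \<subseteq> {\<zero>\<^bsub>quot_alg r I\<^esub>}"
      unfolding carrier_quot_alg by blast
    then have "carrier (quot_alg r I) = {\<zero>\<^bsub>quot_alg r I\<^esub>}"
      using res.S.zero_closed by blast
    from res.S.dimension_trivial_ring[OF _ this] have "h ! 2 = 0"
      using dims[of 2] unfolding has_dim_def by simp
    with pos show False
      by simp
  qed
  have unique: "m = n" if "has_dim r I V m" "has_dim r I V n" for V m n
    using res.S.dimension_is_inj[OF subfield_ground_field[OF one]] that by (simp add: has_dim_def)
  have keys: "\<And>d n. n \<in> monomials r d \<Longrightarrow> Poly_Mapping.keys n \<subseteq> {..<r}"
    by (simp add: monomials_def)
  \<comment> \<open>A nonzero constant is a unit, so it would bring 1 into \<open>I\<close>.\<close>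
  have "supported (monomials r 0) \<inter> I \<subseteq> {0}"
  proof
    fix p assume "p \<in> supported (monomials r 0) \<inter> I"
    then have p: "Poly_Mapping.keys p \<subseteq> {0}" "p \<in> I"
      by (auto simp: monomials_zero supported_def)
    define c where "c = Poly_Mapping.lookup p 0"
    have p_eq: "p = Poly_Mapping.single 0 c"
      using p(1) by (intro poly_mapping_eqI)
        (auto simp: c_def lookup_single when_def in_keys_iff)
    have "c = 0"
    proof (rule ccontr)
      assume "c \<noteq> 0"
      moreover have "Poly_Mapping.single 0 (inverse c) * p \<in> I"
        using I.I_l_closed[OF p(2)] by (simp add: single_in_polys)
      ultimately show False
        using one by (simp add: p_eq mult_single)
    qed
    with p_eq show "p \<in> {0}"
      by simp
  qed
  from has_dim_image_supported[OF finite_monomials keys[of _ 0] this]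
  have "has_dim r I (graded_part r I 0) 1"
    by (simp add: graded_part_eq monomials_zero)
  from unique[OF dims[of 0] this] have h0: "h ! 0 = 1"
    by simp
  have "supported (monomials r 1) \<inter> I \<subseteq> {0}"
    using I(2) by (auto simp: forms_eq_supported)
  from has_dim_image_supported[OF finite_monomials keys[of _ 1] this]
  have "has_dim r I (graded_part r I 1) r"
    by (simp only: graded_part_eq card_monomials_one)
  from unique[OF dims[of 1] this] have h1: "h ! 1 = r"
    by simp
  obtain n where n: "n \<le> (r + 1) choose 2" "has_dim r I (graded_part r I 2) n"
    using ex_dim_image_supported[of "monomials r 2", OF finite_monomials] keys[of _ 2]
    by (auto simp: card_monomials_two graded_part_eq)
  from unique[OF dims[of 2] n(2)] n(1) have le: "h ! 2 \<le> (r + 1) choose 2"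
    by simp
  have "h = [1, r, h ! 2]"
  proof (rule nth_equalityI)
    fix i assume "i < length h"
    then consider "i = 0" | "i = 1" | "i = 2"
      using assms(2) by linarith
    then show "h ! i = [1, r, h ! 2] ! i"
      using h0 h1 by cases simp_all
  qed (simp add: assms(2))
  from this pos le show thesis
    by (rule that)
qed


section \<open>Level algebras with prescribed h-vector\<close>

text \<open>The parameter \<open>K\<close> only fixes the ground field.\<close>

locale level_construction =
  fixes K :: "'k::field itself" and r :: nat and S :: "(nat \<Rightarrow>\<^sub>0 nat) set"
  assumes r: "0 < r"
    and S: "S \<subseteq> monomials r 2"
    and S0: "Poly_Mapping.single 0 2 \<in> S"
begin

text \<open>\<open>Q\<close> consists of the squares identified with \<open>x\<^sub>0\<^sup>2\<close>, and \<open>\<phi> n\<close> is the coordinate of the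
  degree two part with respect to the basis element \<open>n\<close>.\<close>

definition Q :: "(nat \<Rightarrow>\<^sub>0 nat) set"
  where "Q = (\<lambda>j. Poly_Mapping.single j 2) ` {..<r} - S"

definition \<phi> :: "(nat \<Rightarrow>\<^sub>0 nat) \<Rightarrow> 'k mpoly \<Rightarrow> 'k"
  where "\<phi> n f = Poly_Mapping.lookup f n
    + (if n = Poly_Mapping.single 0 2 then (\<Sum>q\<in>Q. Poly_Mapping.lookup f q) else 0)"

text \<open>Linear conditions in place of generators. In degree two they leave exactly the span of
  the differences \<open>q - x_0^2\<close> for \<open>q\<close> in \<open>Q\<close> and of the mixed
  monomials outside \<open>S\<close>; from degree three on everything is allowed.\<close>

definition I :: "'k mpoly set"
  where "I = {f \<in> polys r. (\<forall>m. pp_degree m < 2 \<longrightarrow> Poly_Mapping.lookup f m = 0)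
    \<and> (\<forall>n\<in>S. \<phi> n f = 0)}"

section \<open>The coordinates \<open>\<phi>\<close> and the homogeneous ideal they cut out\<close>

lemma finite_S: "finite S"
  using S finite_monomials by (rule finite_subset)

lemma Q_subset: "Q \<subseteq> monomials r 2"
  by (auto simp: Q_def monomials_def)

lemma degree_S: "n \<in> S \<Longrightarrow> pp_degree n = 2"
  using S by (auto simp: monomials_def)

lemma degree_Q: "n \<in> Q \<Longrightarrow> pp_degree n = 2"
  using Q_subset by (auto simp: monomials_def)

lemma \<phi>_add: "\<phi> n (f + g) = \<phi> n f + \<phi> n g"
  by (simp add: \<phi>_def lookup_add sum.distrib)

lemma \<phi>_diff: "\<phi> n (f - g) = \<phi> n f - \<phi> n g"
  by (simp add: \<phi>_def lookup_minus sum_subtractf)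

lemma \<phi>_uminus: "\<phi> n (- f) = - \<phi> n f"
  by (simp add: \<phi>_def sum_negf)

text \<open>All monomials of \<open>S\<close> and \<open>Q\<close> are quadratic, so
  \<open>\<phi>\<close> sees only the quadratic part.\<close>

lemma \<phi>_cong:
  assumes eq: "\<And>m. pp_degree m = 2 \<Longrightarrow> Poly_Mapping.lookup f m = Poly_Mapping.lookup g m"
    and "n \<in> S"
  shows "\<phi> n f = \<phi> n g"
proof -
  have "(\<Sum>q\<in>Q. Poly_Mapping.lookup f q) = (\<Sum>q\<in>Q. Poly_Mapping.lookup g q)"
    by (intro sum.cong refl eq degree_Q)
  with eq[OF degree_S[OF assms(2)]] show ?thesis
    by (simp only: \<phi>_def)
qed

text \<open>If \<open>f\<close> starts in degree two, \<open>g\<close> scales its quadratic part by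
  its constant term, and \<open>\<phi>\<close> is linear in that part. Hence the vanishing of
  \<open>\<phi>\<close> survives multiplication.\<close>

lemma \<phi>_mult_lowest:
  assumes "\<And>m. pp_degree m < 2 \<Longrightarrow> Poly_Mapping.lookup f m = 0" "n \<in> S"
  shows "\<phi> n (g * f) = Poly_Mapping.lookup g 0 * \<phi> n f"
proof -
  have lookup: "Poly_Mapping.lookup (g * f) m = Poly_Mapping.lookup g 0 * Poly_Mapping.lookup f m"
    if "pp_degree m = 2" for m
    using lookup_mult_lowest[where d = 2 and f = f and m = m and g = g] assms(1) that by simp
  have "(\<Sum>q\<in>Q. Poly_Mapping.lookup (g * f) q)
      = Poly_Mapping.lookup g 0 * (\<Sum>q\<in>Q. Poly_Mapping.lookup f q)"
    unfolding sum_distrib_left by (intro sum.cong refl lookup degree_Q)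
  with lookup[OF degree_S[OF assms(2)]] show ?thesis
    by (simp add: \<phi>_def distrib_left)
qed

lemma ideal_I: "ideal I (poly_ring r)"
proof (rule idealI[OF ring_poly_ring])
  show "subgroup I (add_monoid (poly_ring r))"
  proof (rule group.subgroupI[OF abelian_group.a_group[OF ring.is_abelian_group[OF ring_poly_ring]]])
    have "0 \<in> I"
      by (simp add: I_def \<phi>_def)
    then show "I \<noteq> {}"
      by blast
    fix a assume a: "a \<in> I"
    then have "- a \<in> I"
      by (simp add: I_def \<phi>_uminus)
    then show "inv\<^bsub>add_monoid (poly_ring r)\<^esub> a \<in> I"
      using a a_inv_poly_ring[of a r] by (simp add: a_inv_def I_def)
  qed (auto simp: I_def lookup_add \<phi>_add)
  fix a x :: "'k mpoly"
  assume a: "a \<in> I" and x: "x \<in> carrier (poly_ring r)"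
  have "x * a \<in> I"
  proof -
    have low: "Poly_Mapping.lookup a m = 0" if "pp_degree m < 2" for m
      using a that by (simp add: I_def)
    have "Poly_Mapping.lookup (x * a) m = 0" if "pp_degree m < 2" for m
      using lookup_mult_lowest[where d = 2 and f = a and m = m and g = x] low that by simp
    moreover have "\<phi> n (x * a) = 0" if "n \<in> S" for n
      using \<phi>_mult_lowest[OF low that] a that by (simp add: I_def)
    ultimately show ?thesis
      using a x by (simp add: I_def)
  qed
  then show "x \<otimes>\<^bsub>poly_ring r\<^esub> a \<in> I" "a \<otimes>\<^bsub>poly_ring r\<^esub> x \<in> I"
    by (simp_all add: mult.commute)
qed

sublocale presentation r I
  using ideal_I by (rule presentation.intro)

text \<open>Every condition defining \<open>I\<close> reads coefficients of degree at most
  two.\<close>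

lemma high_degree_mem_I:
  assumes "p \<in> polys r" "\<And>m. pp_degree m \<le> 2 \<Longrightarrow> Poly_Mapping.lookup p m = 0"
  shows "p \<in> I"
  using assms by (simp add: I_def \<phi>_def degree_S degree_Q)

text \<open>The conditions are imposed degree by degree, so \<open>I\<close> contains the
  homogeneous parts of its elements. Each element is the finite sum of its parts, and therefore the
  forms in \<open>I\<close> generate it.\<close>

lemma homogeneous_ideal_I: "homogeneous_ideal r I"
proof -
  let ?F = "I \<inter> (\<Union>d. forms r d)"
  have F: "?F \<subseteq> carrier (poly_ring r)"
    by (auto simp: I_def)
  interpret G: ideal "genideal (poly_ring r) ?F" "poly_ring r"
    using ring.genideal_ideal[OF ring_poly_ring F] .
  have "I \<subseteq> genideal (poly_ring r) ?F"
  proof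
    fix p assume p: "p \<in> I"
    \<comment> \<open>The quadratic part has the same values of \<open>\<phi>\<close> as
      \<open>p\<close>. In degrees zero and one the part is zero, and above two it vanishes up to
      degree two.\<close>
    have "homogeneous_part d p \<in> I" for d
    proof (cases "d = 2")
      case True
      then show ?thesis
        using p mem_polys[OF p] homogeneous_part_in_forms[OF mem_polys[OF p], of d] forms_subset_polys[of r d]
          \<phi>_cong[of "homogeneous_part 2 p" p]
        by (auto simp: I_def lookup_homogeneous_part)
    next
      case False
      then show ?thesis
        using p mem_polys[OF p] homogeneous_part_in_forms[OF mem_polys[OF p], of d] forms_subset_polys[of r d]
        by (intro high_degree_mem_I) (auto simp: I_def lookup_homogeneous_part)
    qed
    then have F_part: "homogeneous_part d p \<in> genideal (poly_ring r) ?F" for d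
      using ring.genideal_self[OF ring_poly_ring F] homogeneous_part_in_forms[OF mem_polys[OF p]]
      by blast
    have "(\<Sum>d\<in>D. homogeneous_part d p) \<in> genideal (poly_ring r) ?F" if "finite D" for D
      using that
    proof (induction rule: finite_induct)
      case empty
      show ?case
        using additive_subgroup.zero_closed[OF G.is_additive_subgroup] by simp
    next
      case (insert d D)
      then show ?case
        using additive_subgroup.a_closed[OF G.is_additive_subgroup F_part] by simp
    qed
    moreover have "p = (\<Sum>d\<in>pp_degree ` Poly_Mapping.keys p. homogeneous_part d p)"
      by (rule poly_mapping_eqI)
        (auto simp: lookup_sum lookup_homogeneous_part image_iff in_keys_iff)
    ultimately show "p \<in> genideal (poly_ring r) ?F"
      by (metis finite_imageI finite_keys)
  qed
  moreover have "genideal (poly_ring r) ?F \<subseteq> I"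
    by (rule ring.genideal_minimal[OF ring_poly_ring ideal_I]) simp
  ultimately show ?thesis
    unfolding homogeneous_ideal_def using ideal_I by blast
qed

lemma I_Int_forms_one: "\<forall>f\<in>I \<inter> forms r 1. f = 0"
proof
  fix f assume f: "f \<in> I \<inter> forms r 1"
  then have "Poly_Mapping.lookup f m = 0" for m
    by (cases "pp_degree m = 1") (auto simp: I_def forms_def in_keys_iff)
  then show "f = 0"
    by (intro poly_mapping_eqI) simp
qed

lemma one_notin_I: "1 \<notin> I"
proof
  assume "1 \<in> I"
  then have "Poly_Mapping.lookup (1::'k mpoly) 0 = 0"
    by (simp add: I_def del: lookup_one_zero)
  then show False
    by simp
qed

section \<open>Normal forms in the basis \<open>S\<close> of degree two, and the h-vector\<close>

definition normal_form :: "'k mpoly \<Rightarrow> 'k mpoly"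
  where "normal_form f = (\<Sum>n\<in>S. Poly_Mapping.single n (\<phi> n f))"

lemma lookup_normal_form:
  "Poly_Mapping.lookup (normal_form f) m = (if m \<in> S then \<phi> m f else 0)"
  by (simp add: normal_form_def lookup_sum lookup_single when_def finite_S)

lemma normal_form_in_supported: "normal_form f \<in> supported S"
  by (auto simp: supported_def in_keys_iff lookup_normal_form split: if_splits)

text \<open>\<open>Q\<close> is disjoint from \<open>S\<close>, so the correction term vanishes and
  the functionals are dual to the monomials of \<open>S\<close>.\<close>

lemma \<phi>_supported:
  assumes "f \<in> supported S"
  shows "\<phi> n f = Poly_Mapping.lookup f n"
proof -
  have "Poly_Mapping.lookup f q = 0" if "q \<in> Q" for q
    using assms that by (auto simp: supported_def Q_def in_keys_iff)
  then show ?thesis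
    by (simp add: \<phi>_def)
qed

lemma keys_S: "n \<in> S \<Longrightarrow> Poly_Mapping.keys n \<subseteq> {..<r}"
  using S by (auto simp: monomials_def)

lemma supported_S_subset: "supported S \<subseteq> forms r 2"
  using S by (auto simp: forms_eq_supported supported_def)

text \<open>By this duality, \<open>f\<close> and its normal form have the same coordinates.\<close>

lemma diff_normal_form_mem_I:
  assumes "f \<in> forms r 2"
  shows "f - normal_form f \<in> I"
proof -
  have "normal_form f \<in> forms r 2"
    using normal_form_in_supported supported_S_subset by blast
  then have "f - normal_form f \<in> forms r 2"
    using assms keys_diff[of f "normal_form f"] by (auto simp: forms_eq_supported supported_def)
  then have "f - normal_form f \<in> polys r"
    "pp_degree m < 2 \<Longrightarrow> Poly_Mapping.lookup (f - normal_form f) m = 0" for m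
    using forms_subset_polys[of r 2] by (auto simp: lookup_form_eq_zero)
  moreover have "\<phi> n (f - normal_form f) = 0" if "n \<in> S" for n
    using that
    by (simp add: \<phi>_diff \<phi>_supported[OF normal_form_in_supported] lookup_normal_form)
  ultimately show ?thesis
    by (simp add: I_def)
qed

lemma graded_part_two: "graded_part r I 2 = residue_class r I ` supported S"
proof (intro equalityI subsetI)
  fix a assume "a \<in> graded_part r I 2"
  then obtain f where f: "f \<in> forms r 2" "a = residue_class r I f"
    by (auto simp: graded_part_def)
  have "normal_form f \<in> polys r"
    using normal_form_in_supported supported_S_subset forms_subset_polys by blast
  then have "a = residue_class r I (normal_form f)"
    using f forms_subset_polys diff_normal_form_mem_I[OF f(1)] residue_class_eq_iff by blast
  then show "a \<in> residue_class r I ` supported S"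
    using normal_form_in_supported by blast
qed (use supported_S_subset in \<open>auto simp: graded_part_def\<close>)

text \<open>\<open>I\<close> meets the spans of the monomials of degree zero and one, and the span
  of \<open>S\<close>, only in zero, so these monomials are counted. All forms of degree at least
  three lie in \<open>I\<close>.\<close>

lemma has_dim_graded_part:
  "has_dim r I (graded_part r I 0) 1"
  "has_dim r I (graded_part r I 1) r"
  "has_dim r I (graded_part r I 2) (card S)"
  "3 \<le> i \<Longrightarrow> has_dim r I (graded_part r I i) 0"
proof -
  have low: "supported (monomials r d) \<inter> I \<subseteq> {0}" if "d < 2" for d
  proof
    fix p assume p: "p \<in> supported (monomials r d) \<inter> I"
    then have "Poly_Mapping.lookup p m = 0" for m
      using that by (cases "pp_degree m = d") (auto simp: I_def supported_def monomials_def in_keys_iff)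
    then show "p \<in> {0}"
      by (simp add: poly_mapping_eqI)
  qed
  have keys: "\<And>d n. n \<in> monomials r d \<Longrightarrow> Poly_Mapping.keys n \<subseteq> {..<r}"
    by (simp add: monomials_def)
  show "has_dim r I (graded_part r I 0) 1"
    using has_dim_image_supported[OF finite_monomials keys[of _ 0] low[of 0]]
    by (simp add: graded_part_eq monomials_zero)
  show "has_dim r I (graded_part r I 1) r"
    using has_dim_image_supported[OF finite_monomials keys[of _ 1] low[of 1]]
    by (simp add: graded_part_eq card_monomials_one del: One_nat_def)
  have "supported S \<inter> I \<subseteq> {0}"
  proof
    fix p assume p: "p \<in> supported S \<inter> I"
    have "Poly_Mapping.lookup p m = 0" for m
    proof (cases "m \<in> S")
      case True
      with p \<phi>_supported[of p m] show ?thesis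
        by (simp add: I_def)
    qed (use p in \<open>auto simp: supported_def in_keys_iff\<close>)
    then show "p \<in> {0}"
      by (simp add: poly_mapping_eqI)
  qed
  from has_dim_image_supported[OF finite_S keys_S this]
  show "has_dim r I (graded_part r I 2) (card S)"
    by (simp add: graded_part_two)
  assume i: "3 \<le> i"
  have "f \<in> I" if "f \<in> forms r i" for f
    using that i forms_subset_polys[of r i]
    by (intro high_degree_mem_I) (auto simp: lookup_form_eq_zero)
  then have "residue_class r I f = \<zero>\<^bsub>quot_alg r I\<^esub>" if "f \<in> forms r i" for f
    using that residue_class_eq_zero_iff[of f] forms_subset_polys by blast
  moreover have "0 \<in> forms r i"
    by (simp add: forms_def)
  ultimately have "graded_part r I i = {\<zero>\<^bsub>quot_alg r I\<^esub>}"
    unfolding graded_part_def by blast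
  then show "has_dim r I (graded_part r I i) 0"
    by (simp add: has_dim_def)
qed

text \<open>Truncating a polynomial after degree two does not change its class, so finitely many
  monomials span the algebra.\<close>

lemma artinian_quot_alg: "artinian (quot_alg r I)"
proof (rule artinian_if_finite_dimension)
  show "cring (quot_alg r I)"
    by (rule res.S.cring_axioms)
  show "subfield (ground_field r I) (quot_alg r I)"
    by (rule subfield_ground_field[OF one_notin_I])
  let ?B = "monomials r 0 \<union> monomials r 1 \<union> monomials r 2"
  have "carrier (quot_alg r I) \<subseteq> residue_class r I ` supported ?B"
  proof
    fix a assume "a \<in> carrier (quot_alg r I)"
    then obtain f where f: "f \<in> polys r" "a = residue_class r I f"
      by (auto simp: carrier_quot_alg)
    define g where "g = homogeneous_part 0 f + homogeneous_part 1 f + homogeneous_part 2 f"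
    have degree_le: "pp_degree m \<le> 2 \<longleftrightarrow> m = 0 \<or> pp_degree m = 1 \<or> pp_degree m = 2" for m
      using pp_degree_eq_zero_iff[of m] by linarith
    have lookup: "Poly_Mapping.lookup g m = (if pp_degree m \<le> 2 then Poly_Mapping.lookup f m else 0)" for m
      using degree_le[of m] by (auto simp: g_def lookup_add lookup_homogeneous_part)
    have g: "g \<in> polys r"
      using f(1) by (auto simp: polys_iff_lookup lookup split: if_splits)
    have "f - g \<in> I"
      using f(1) g by (intro high_degree_mem_I) (auto simp: lookup lookup_minus)
    then have "a = residue_class r I g"
      using residue_class_eq_iff[OF f(1) g] f(2) by simp
    moreover have "g \<in> supported ?B"
      using f(1)
      by (auto simp: supported_def in_keys_iff lookup monomials_def polys_iff_lookup degree_le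
          split: if_splits)
    ultimately show "a \<in> residue_class r I ` supported ?B"
      by blast
  qed
  moreover have "residue_class r I ` supported ?B \<subseteq> carrier (quot_alg r I)"
    unfolding carrier_quot_alg by (intro image_mono supported_subset_polys) (auto simp: monomials_def)
  ultimately have "carrier (quot_alg r I) = residue_class r I ` supported ?B"
    by (rule equalityI)
  moreover have "\<exists>n\<le>card ?B. has_dim r I (residue_class r I ` supported ?B) n"
    by (rule ex_dim_image_supported) (simp, auto simp: monomials_def)
  ultimately show "res.S.finite_dimension (ground_field r I) (carrier (quot_alg r I))"
    by (auto simp: res.S.finite_dimension_def has_dim_def)
qed

text \<open>The square of \<open>x_i\<close> is divisible by \<open>x_j\<close> only for
  \<open>i = j\<close>, and the cofactor is then \<open>x_j\<close>.\<close>

lemma single_times_square_lookup: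
  fixes i j :: nat
  shows "Poly_Mapping.lookup (Poly_Mapping.single (Poly_Mapping.single j 1) 1 * f)
      (Poly_Mapping.single i (2::nat))
    = (if i = j then Poly_Mapping.lookup f (Poly_Mapping.single j 1) else (0::'k))"
proof (cases "i = j")
  case True
  have "Poly_Mapping.single i 2 = Poly_Mapping.single i 1 + Poly_Mapping.single i (1::nat)"
    by (simp flip: single_add add: numeral_2_eq_2)
  with True lookup_single_mult_add[of "Poly_Mapping.single j 1" 1 f "Poly_Mapping.single j 1"]
  show ?thesis
    by simp
next
  case False
  have "Poly_Mapping.single i 2 \<noteq> Poly_Mapping.single j (1::nat) + q" for q
  proof
    assume "Poly_Mapping.single i 2 = Poly_Mapping.single j (1::nat) + q"
    from arg_cong[OF this, of "\<lambda>m. Poly_Mapping.lookup m j"] False show False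
      by (simp add: lookup_add lookup_single)
  qed
  with False show ?thesis
    by (simp add: lookup_single_mult_eq_0)
qed

text \<open>The functional attached to \<open>x\<^sub>j\<^sup>2\<close>, or to \<open>x\<^sub>0\<^sup>2\<close> if \<open>x\<^sub>j\<^sup>2 \<notin> S\<close>,
  recovers the coefficient of \<open>x\<^sub>j\<close> in \<open>f\<close> from \<open>x\<^sub>j f\<close>.\<close>

lemma linear_coeff_eq_zero:
  assumes f: "Poly_Mapping.single (Poly_Mapping.single j 1) 1 * f \<in> I" and j: "j < r"
  shows "Poly_Mapping.lookup f (Poly_Mapping.single j 1) = 0"
proof -
  let ?g = "Poly_Mapping.single (Poly_Mapping.single j 1) 1 * f"
  define c where "c = Poly_Mapping.lookup f (Poly_Mapping.single j 1)"
  have coeff: "Poly_Mapping.lookup ?g (Poly_Mapping.single i 2) = (if i = j then c else 0)" for i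
    unfolding c_def by (rule single_times_square_lookup)
  have sq_inj: "Poly_Mapping.single i (2::nat) = Poly_Mapping.single j 2 \<longleftrightarrow> i = j" for i
    by (metis lookup_single_eq lookup_single_not_eq zero_neq_numeral)
  have "Poly_Mapping.lookup ?g q = (if q = Poly_Mapping.single j 2 then c else 0)" if "q \<in> Q" for q
    using that coeff sq_inj by (auto simp: Q_def)
  then have sum: "(\<Sum>q\<in>Q. Poly_Mapping.lookup ?g q) = (if Poly_Mapping.single j 2 \<in> Q then c else 0)"
    using finite_subset[OF Q_subset] by (simp add: sum.delta)
  show "c = 0"
  proof (cases "Poly_Mapping.single j 2 \<in> S")
    case True
    then have "\<phi> (Poly_Mapping.single j 2) ?g = c"
      using coeff sum by (simp add: \<phi>_def Q_def)
    with f True show ?thesis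
      by (simp add: I_def)
  next
    case False
    then have "Poly_Mapping.single j 2 \<in> Q"
      using j by (simp add: Q_def)
    \<comment> \<open>So \<open>x_0^2\<close> has coefficient zero in \<open>?g\<close>, and the
      functional at \<open>x_0^2\<close> receives \<open>c\<close> from \<open>x_j^2\<close> through
      \<open>Q\<close>.\<close>
    moreover have "j \<noteq> 0"
      using S0 False by metis
    ultimately have "\<phi> (Poly_Mapping.single 0 2) ?g = c"
      using coeff[of 0] sum by (simp add: \<phi>_def)
    with f S0 show ?thesis
      by (simp add: I_def)
  qed
qed

text \<open>Multiplying a socle element by the variables kills its constant and linear coefficients;
  its terms above degree two are zero in the quotient. Conversely, a quadratic form times a
  polynomial without constant term starts in degree three.\<close>

lemma socle_eq: "socle r I = graded_part r I 2"
proof (intro equalityI subsetI)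
  fix a assume a: "a \<in> socle r I"
  then obtain f where f: "f \<in> polys r" "a = residue_class r I f"
    by (auto simp: socle_def carrier_quot_alg)
  have x: "Poly_Mapping.single (Poly_Mapping.single j 1) 1 * f \<in> I" if "j < r" for j
  proof -
    let ?x = "Poly_Mapping.single (Poly_Mapping.single j 1) (1::'k)"
    have x: "?x \<in> polys r"
      using that by (intro single_in_polys) simp
    have "Poly_Mapping.single j (1::nat) \<noteq> 0"
      by (metis lookup_single_eq lookup_zero one_neq_zero)
    then have "residue_class r I ?x \<in> homogeneous_maximal_ideal r I"
      using x by (simp add: homogeneous_maximal_ideal_def lookup_single)
    then have "residue_class r I ?x \<otimes>\<^bsub>quot_alg r I\<^esub> residue_class r I f = \<zero>\<^bsub>quot_alg r I\<^esub>"
      using a f(2) unfolding socle_def by blast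
    then have "residue_class r I (?x * f) = \<zero>\<^bsub>quot_alg r I\<^esub>"
      using residue_class_eq_mult[OF x f(1)] by simp
    then show ?thesis
      using f x residue_class_eq_zero_iff[of "?x * f"] by simp
  qed
  have low: "Poly_Mapping.lookup f m = 0" if m: "pp_degree m < 2" for m
  proof (cases "m \<in> monomials r 0 \<or> m \<in> monomials r 1")
    case True
    then consider "m = 0" | j where "j < r" "m = Poly_Mapping.single j 1"
      unfolding monomials_zero monomials_one by blast
    then show ?thesis
    proof cases
      case 1
      \<comment> \<open>The constant term of \<open>f\<close> reappears as the coefficient of
        \<open>x_0\<close> in \<open>x_0 f\<close>, and elements of \<open>I\<close> have no linear
        terms.\<close>
      have "Poly_Mapping.lookup (Poly_Mapping.single (Poly_Mapping.single 0 1) 1 * f)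
          (Poly_Mapping.single 0 1 + 0) = 0"
        using x[OF r] by (simp add: I_def)
      with 1 show ?thesis
        by (simp only: lookup_single_mult_add) simp
    qed (use linear_coeff_eq_zero x in auto)
  next
    case False
    \<comment> \<open>A monomial of degree below two can miss both lists only by involving a
      variable outside the ring.\<close>
    then have "\<not> Poly_Mapping.keys m \<subseteq> {..<r}"
      using m by (auto simp: monomials_def less_2_cases_iff)
    then show ?thesis
      using f(1) by (auto simp: polys_iff_lookup)
  qed
  have part: "homogeneous_part 2 f \<in> forms r 2"
    using f(1) by (rule homogeneous_part_in_forms)
  moreover have "f - homogeneous_part 2 f \<in> I"
    using f(1) part forms_subset_polys[of r 2] low
    by (intro high_degree_mem_I) (auto simp: lookup_minus lookup_homogeneous_part le_less)
  ultimately show "a \<in> graded_part r I 2"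
    using f forms_subset_polys[of r 2] residue_class_eq_iff[of f "homogeneous_part 2 f"]
    by (auto simp: graded_part_def)
next
  fix a assume "a \<in> graded_part r I 2"
  then obtain f where f: "f \<in> forms r 2" "a = residue_class r I f"
    by (auto simp: graded_part_def)
  have f_polys: "f \<in> polys r"
    using f(1) forms_subset_polys by blast
  have low: "Poly_Mapping.lookup f m = 0" if "pp_degree m < 2" for m
    using f(1) that by (auto simp: lookup_form_eq_zero)
  have "g * f \<in> I" if g: "g \<in> polys r" "Poly_Mapping.lookup g 0 = 0" for g
  proof (rule high_degree_mem_I)
    show "g * f \<in> polys r"
      using g f_polys by simp
    show "Poly_Mapping.lookup (g * f) m = 0" if "pp_degree m \<le> 2" for m
      using lookup_mult_lowest[where d = 2 and f = f and m = m and g = g] low that g(2) by simp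
  qed
  then have "residue_class r I g \<otimes>\<^bsub>quot_alg r I\<^esub> a = \<zero>\<^bsub>quot_alg r I\<^esub>"
    if "g \<in> polys r" "Poly_Mapping.lookup g 0 = 0" for g
    using that f(2) f_polys residue_class_eq_zero_iff[of "g * f"]
    by (simp add: residue_class_eq_mult)
  then show "a \<in> socle r I"
    using f(2) f_polys by (auto simp: socle_def homogeneous_maximal_ideal_def carrier_quot_alg)
qed

lemma level_h_vector: "level_h_vector TYPE('k) [1, r, card S]"
  unfolding level_h_vector_def
proof (intro exI conjI)
  show "standard_graded_artinian r I"
    using homogeneous_ideal_I I_Int_forms_one artinian_quot_alg
    by (simp add: standard_graded_artinian_def)
  have "card S \<noteq> 0"
    using finite_S S0 by auto
  moreover have "has_dim r I (graded_part r I i) ([1, r, card S] ! i)" if i: "i < 3" for i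
  proof -
    consider "i = 0" | "i = 1" | "i = 2"
      using i by linarith
    then show ?thesis
      by cases (use has_dim_graded_part in simp_all)
  qed
  ultimately show "has_h_vector r I [1, r, card S]"
    using has_dim_graded_part(4) by (simp add: has_h_vector_def numeral_3_eq_3)
  show "level_of_type r I [1, r, card S] (card S)"
    using has_dim_graded_part(3) by (simp add: level_of_type_def socle_eq socle_degree_def flip: numeral_2_eq_2)
qed

end

text \<open>Any \<open>t\<close> quadratic monomials including \<open>x_0^2\<close> can serve as
  \<open>S\<close>; the two bounds on \<open>t\<close> guarantee such a choice.\<close>

theorem level_h_vector_codim_type_iff:
  "level_h_vector TYPE('k::field) [1, r, t] \<longleftrightarrow> 1 \<le> t \<and> t \<le> (r + 1) choose 2"
proof
  assume "level_h_vector TYPE('k) [1, r, t]"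
  then show "1 \<le> t \<and> t \<le> (r + 1) choose 2"
    by (elim level_h_vector_length_3D) auto
next
  assume t: "1 \<le> t \<and> t \<le> (r + 1) choose 2"
  \<comment> \<open>For \<open>r = 0\<close> the upper bound \<open>1 choose 2\<close> is
    zero.\<close>
  then have r: "0 < r"
    by (cases r) (auto simp: numeral_2_eq_2)
  have "Poly_Mapping.single 0 2 \<in> monomials r 2"
    using r by (simp add: monomials_def del: single_numeral)
  then have "\<exists>S. {Poly_Mapping.single 0 2} \<subseteq> S \<and> S \<subseteq> monomials r 2 \<and> card S = t"
    using t by (intro exists_subset_between) (simp_all add: card_monomials_two)
  then obtain S where S: "Poly_Mapping.single 0 2 \<in> S" "S \<subseteq> monomials r 2" "card S = t"
    by blast
  have "level_construction r S"
    using r S(2,1) by (rule level_construction.intro)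
  then show "level_h_vector TYPE('k) [1, r, t]"
    unfolding S(3)[symmetric] by (rule level_construction.level_h_vector)
qed


section \<open>Binomial expansions in degree two\<close>

text \<open>The expansion ends at index 2 or at index 1 according to its length, whence the bounds
  \<open>n \<ge> 2\<close> and \<open>1 \<le> m\<close>.\<close>

lemma is_binomial_expansion_2_iff:
  "is_binomial_expansion 2 t ns \<longleftrightarrow>
    (\<exists>n\<ge>2. ns = [n] \<and> t = n choose 2) \<or> (\<exists>n m. ns = [n, m] \<and> 1 \<le> m \<and> m < n \<and> t = (n choose 2) + m)"
proof -
  have "ns \<noteq> [] \<and> length ns \<le> 2 \<longleftrightarrow> (\<exists>n. ns = [n]) \<or> (\<exists>n m. ns = [n, m])"
    by (cases ns; cases "tl ns") (auto simp: length_Suc_conv)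
  then show ?thesis
    by (auto simp: is_binomial_expansion_def numeral_2_eq_2 lessThan_Suc)
qed

lemma Suc_choose_two: "Suc n choose 2 = (n choose 2) + n"
  by (simp add: numeral_2_eq_2)

lemma choose_two_mono: "m \<le> n \<Longrightarrow> m choose 2 \<le> n choose 2"
  by (induction rule: dec_induct) (simp_all add: Suc_choose_two)

text \<open>The second entry is below the first, so it cannot reach the next triangular number. This
  locates \<open>t\<close> between two consecutive ones.\<close>

lemma is_binomial_expansion_2_hd:
  assumes "is_binomial_expansion 2 t ns"
  shows "2 \<le> hd ns" "hd ns choose 2 \<le> t" "t < Suc (hd ns) choose 2"
  using assms by (auto simp: is_binomial_expansion_2_iff Suc_choose_two)

text \<open>The intervals between consecutive triangular numbers are disjoint, so the leading
  entries agree; the remainder then fixes the rest.\<close>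

lemma is_binomial_expansion_2_unique:
  assumes "is_binomial_expansion 2 t ns" "is_binomial_expansion 2 t ms"
  shows "ns = ms"
proof -
  have "hd ns = hd ms"
  proof (rule ccontr)
    assume "hd ns \<noteq> hd ms"
    then consider "Suc (hd ns) \<le> hd ms" | "Suc (hd ms) \<le> hd ns"
      by linarith
    then have "Suc (hd ns) choose 2 \<le> hd ms choose 2 \<or> Suc (hd ms) choose 2 \<le> hd ns choose 2"
      by cases (simp_all only: choose_two_mono simp_thms)
    then show False
      using is_binomial_expansion_2_hd[OF assms(1)] is_binomial_expansion_2_hd[OF assms(2)]
      by linarith
  qed
  then show ?thesis
    using assms by (auto simp: is_binomial_expansion_2_iff)
qed

text \<open>Counting up raises the second entry until it would equal \<open>n\<close>; then
  \<open>(n choose 2) + n = Suc n choose 2\<close> carries into the leading entry.\<close>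

lemma ex_binomial_expansion_2:
  assumes "0 < t"
  shows "\<exists>ns. is_binomial_expansion 2 t ns"
  using assms
proof (induction t)
  case (Suc t)
  show ?case
  proof (cases "t = 0")
    case True
    then show ?thesis
      by (intro exI[of _ "[2]"]) (simp add: is_binomial_expansion_2_iff)
  next
    case False
    with Suc obtain ns where "is_binomial_expansion 2 t ns"
      by auto
    then consider n where "n \<ge> 2" "t = n choose 2"
      | n m where "1 \<le> m" "Suc m < n" "t = (n choose 2) + m"
      | n m where "1 \<le> m" "Suc m = n" "t = (n choose 2) + m"
      unfolding is_binomial_expansion_2_iff using Suc_lessI by blast
    then show ?thesis
    proof cases
      case (1 n)
      then show ?thesis
        by (intro exI[of _ "[n, 1]"]) (simp add: is_binomial_expansion_2_iff)
    next
      case (2 n m)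
      then show ?thesis
        by (intro exI[of _ "[n, Suc m]"]) (simp add: is_binomial_expansion_2_iff)
    next
      case (3 n m)
      then show ?thesis
        by (intro exI[of _ "[Suc n]"]) (auto simp: is_binomial_expansion_2_iff Suc_choose_two)
    qed
  qed
qed simp

text \<open>The shift sends \<open>[n]\<close> to \<open>n - 1\<close> and \<open>[n, m]\<close> to
  \<open>(n - 1) + 1 = n\<close>. Each value is the least \<open>r\<close> whose triangular number
  \<open>(r + 1) choose 2\<close> reaches \<open>t\<close>.\<close>

lemma shifted_expansion_le_iff:
  assumes "0 < t"
  shows "shifted_expansion t 2 (- 1) \<le> r \<longleftrightarrow> t \<le> (r + 1) choose 2"
proof -
  obtain ns where ns: "is_binomial_expansion 2 t ns"
    using ex_binomial_expansion_2[OF assms] by blast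
  then have "binomial_expansion 2 t = ns"
    unfolding binomial_expansion_def using is_binomial_expansion_2_unique by blast
  then have shifted: "shifted_expansion t 2 (- 1)
      = (\<Sum>l<length ns. int_binomial (int (ns ! l) - 1) (int (2 - l) - 1))"
    by (simp add: shifted_expansion_def)
  from ns consider n where "n \<ge> 2" "ns = [n]" "t = n choose 2"
    | n m where "1 \<le> m" "m < n" "ns = [n, m]" "t = (n choose 2) + m"
    unfolding is_binomial_expansion_2_iff by blast
  then show ?thesis
  proof cases
    case (1 n)
    have "n \<le> Suc r \<longleftrightarrow> n choose 2 \<le> Suc r choose 2"
    proof
      assume le: "n choose 2 \<le> Suc r choose 2"
      show "n \<le> Suc r"
      proof (rule ccontr)
        assume "\<not> n \<le> Suc r"
        \<comment> \<open>Together these give \<open>n choose 2 \<le> n - 1 choose 2\<close>,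
          although the two differ by \<open>n - 1 \<ge> 1\<close>.\<close>
        then have "Suc (n - 1) choose 2 \<le> Suc r choose 2" "Suc r choose 2 \<le> n - 1 choose 2"
          using le 1(1) by (auto intro: choose_two_mono)
        with 1(1) show False
          by (simp add: Suc_choose_two del: Suc_diff_1 Suc_pred)
      qed
    qed (rule choose_two_mono)
    moreover have "shifted_expansion t 2 (- 1) = n - 1"
      unfolding shifted using 1 by (simp add: int_binomial_def nat_diff_distrib)
    ultimately show ?thesis
      using 1 by auto
  next
    case (2 n m)
    have "n \<le> r \<longleftrightarrow> (n choose 2) + m \<le> Suc r choose 2"
    proof
      assume "n \<le> r"
      then have "Suc n choose 2 \<le> Suc r choose 2"
        by (intro choose_two_mono) simp
      with 2(2) show "(n choose 2) + m \<le> Suc r choose 2"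
        by (simp add: Suc_choose_two)
    next
      assume le: "(n choose 2) + m \<le> Suc r choose 2"
      show "n \<le> r"
      proof (rule ccontr)
        assume "\<not> n \<le> r"
        then have "Suc r choose 2 \<le> n choose 2"
          by (intro choose_two_mono) simp
        with le 2(1) show False
          by simp
      qed
    qed
    \<comment> \<open>The second summand is \<open>(m - 1) choose 0\<close>, which is 1 because
      \<open>m \<ge> 1\<close>.\<close>
    moreover have "shifted_expansion t 2 (- 1) = n"
      unfolding shifted using 2 by (simp add: int_binomial_def lessThan_Suc nat_diff_distrib numeral_2_eq_2)
    ultimately show ?thesis
      using 2 by simp
  qed
qed

text \<open>The region \<open>1 \<le> t \<le> (r + 1) choose 2\<close> is stable under raising
  \<open>r\<close> and under lowering \<open>t\<close> down to 1, so it has no gaps in either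
  direction. Both sharp bounds describe its boundary, once for fixed \<open>t\<close> and once for
  fixed \<open>r\<close>.\<close>

theorem proposition3p3:
  shows "interval_conjecture_holds
      {h. level_h_vector TYPE('k::field_char_0) h \<and> socle_degree h = 2} \<and>
    (\<forall>t>0.
      (\<forall>r\<ge>shifted_expansion t 2 (- 1). level_h_vector TYPE('k) [1, r, t]) \<and>
      (\<forall>r<shifted_expansion t 2 (- 1). \<not> level_h_vector TYPE('k) [1, r, t])) \<and>
    (\<forall>r>0.
      (\<forall>t. 1 \<le> t \<and> t \<le> (r + 1) choose 2 \<longrightarrow> level_h_vector TYPE('k) [1, r, t]) \<and>
      (\<forall>t > (r + 1) choose 2. \<not> level_h_vector TYPE('k) [1, r, t]))"
proof -
  note iff = level_h_vector_codim_type_iff[where 'k = 'k]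
  show ?thesis
  proof (intro conjI)
    show "interval_conjecture_holds {h. level_h_vector TYPE('k) h \<and> socle_degree h = 2}"
      unfolding interval_conjecture_holds_def
    proof (intro allI impI)
      fix h :: "nat list" and i \<alpha> \<beta> :: nat
      assume "1 \<le> i \<and> i < length h \<and> \<alpha> > 0 \<and> h \<in> {h. level_h_vector TYPE('k) h \<and> socle_degree h = 2}
        \<and> h[i := h ! i + \<alpha>] \<in> {h. level_h_vector TYPE('k) h \<and> socle_degree h = 2}"
        and \<beta>: "\<beta> \<le> \<alpha>"
      then have i: "1 \<le> i" "i < length h" and h: "level_h_vector TYPE('k) h" "socle_degree h = 2"
        and h': "level_h_vector TYPE('k) (h[i := h ! i + \<alpha>])"
        by blast+
      have "length h = 3"
        using i h(2) by (simp add: socle_degree_def)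
      with h(1) obtain r t where h_eq: "h = [1, r, t]" and t: "0 < t" "t \<le> (r + 1) choose 2"
        by (rule level_h_vector_length_3D)
      consider "i = 1" | "i = 2"
        using i \<open>length h = 3\<close> by linarith
      then have "level_h_vector TYPE('k) (h[i := h ! i + \<beta>])"
      proof cases
        case 1
        \<comment> \<open>The bound on \<open>t\<close> grows with the codimension, so it carries
          over from the lower endpoint.\<close>
        have "(r + 1) choose 2 \<le> (r + \<beta> + 1) choose 2"
          by (rule choose_two_mono) simp
        with t have "level_h_vector TYPE('k) [1, r + \<beta>, t]"
          unfolding iff by linarith
        with 1 h_eq show ?thesis
          by simp
      next
        case 2
        \<comment> \<open>Here the upper endpoint supplies the bound, since
          \<open>t + \<beta> \<le> t + \<alpha>\<close>.\<close>
        then have "level_h_vector TYPE('k) [1, r, t + \<alpha>]"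
          using h' h_eq by simp
        then have "level_h_vector TYPE('k) [1, r, t + \<beta>]"
          unfolding iff using \<beta> t by linarith
        with 2 h_eq show ?thesis
          by simp
      qed
      then show "h[i := h ! i + \<beta>] \<in> {h. level_h_vector TYPE('k) h \<and> socle_degree h = 2}"
        using h(2) by (simp add: socle_degree_def)
    qed
  next
    have "level_h_vector TYPE('k) [1, r, t] \<longleftrightarrow> shifted_expansion t 2 (- 1) \<le> r" if "0 < t" for r t
      unfolding iff shifted_expansion_le_iff[OF that] using that by simp
    then show "\<forall>t>0. (\<forall>r\<ge>shifted_expansion t 2 (- 1). level_h_vector TYPE('k) [1, r, t]) \<and>
        (\<forall>r<shifted_expansion t 2 (- 1). \<not> level_h_vector TYPE('k) [1, r, t])"
      by (simp add: not_le)
  next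
    show "\<forall>r>0. (\<forall>t. 1 \<le> t \<and> t \<le> (r + 1) choose 2 \<longrightarrow> level_h_vector TYPE('k) [1, r, t]) \<and>
        (\<forall>t > (r + 1) choose 2. \<not> level_h_vector TYPE('k) [1, r, t])"
      unfolding iff by (simp add: not_le)
  qed
qed

end
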